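(* Suppose $S\subseteq2^{<\omega_1}$ is a complete coherent Suslin tree, $\mathcal{F}$ is a 2-thin Kurepa family with respect to $S$, and $c:[S]^2\to2$ is a coloring satisfying (coh) and (hom). Then for every $s\in S$, $0<n<\omega$ and every uncountable family $\mathcal{A}\subseteq[\mathcal{X}_{s,n}]^{<\omega}$ with $\{\bigcup x:x\in\mathcal{A}\}$ pairwise disjoint, there exists $\mathcal{B}\in[\mathcal{A}]^{\omega_1}$ such that for all $x\neq y$ in $\mathcal{B}$ and all $a\in x$, $b\in y$, if $a(2n-1)<_Sb(2n-1)$, then for some $i<2$, $$c(a(j),b(k))=i\ \text{ and }\ c(a(n+j),b(n+k))=1-i\quad\text{whenever } j,k<n.$$
   Context: Trees. A Suslin tree here is an uncountable subset $S\subseteq2^{<\omega_1}$ closed under initial segments, ordered by $<_S$ (proper extension of functions), with no uncountable chain and no uncountable antichain. For $t\in S$, $ht(t)=dom(t)$; $S_\alpha=\{t\in S:ht(t)=\alpha\}$; $S\upharpoonright\alpha=\bigcup_{\beta<\alpha}S_\beta$. For $s,t\in2^{<\omega_1}$, $\Delta(s,t)=\max\{\alpha\le\min\{dom(s),dom(t)\}:s\upharpoonright\alpha=t\upharpoonright\alpha\}$ and $D_{s,t}=\{\xi<\min\{dom(s),dom(t)\}:s(\xi)\ne t(\xi)\}$. $S$ is coherent if $D_{s,t}$ is finite for all $s,t\in S$; a coherent $S$ is complete if for all $s\in S$ and $t\in2^{ht(s)}$, $D_{s,t}$ finite implies $t\in S$. Height order. For $s\ne t$ in $2^{<\omega_1}$,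 $s<_{ho}t$ iff $ht(s)<ht(t)$, or $ht(s)=ht(t)$ and $s(\Delta(s,t))<t(\Delta(s,t))$. For finite $a\subseteq2^{<\omega_1}$, $a(0),a(1),\dots,a(|a|-1)$ is the $<_{ho}$-increasing enumeration of $a$. For $s\in S$ and $0<n<\omega$, $\mathcal{X}_{s,n}$ is the collection of all $a\in[S]^{2n}$ such that (1) $s\cup\{(ht(s),0)\}<_Sa(0)<_S\dots<_Sa(n-1)$ and $s\cup\{(ht(s),1)\}<_Sa(n)<_S\dots<_Sa(2n-1)$; (2) $ht(a(n-1))<ht(a(n))$ and $D_{a(n-1),a(n)}=\{ht(s)\}$. $\mathscr{A}\subseteq[S]^{<\omega}$ is non-overlapping if for $a\ne b$ in $\mathscr{A}$, either $\max\{ht(s):s\in a\}<\min\{ht(t):t\in b\}$ or $\max\{ht(t):t\in b\}<\min\{ht(s):s\in a\}$. For $a\subseteq S$ and $\mathcal{F}'\subseteq P([S]^{<\omega})$ consisting of pairwise disjoint families, $cl(a,\mathcal{F}')$ is the $\subseteq$-least $a^*\subseteq S$ such that $a\subseteq a^*$ and for all $\mathscr{A}\in\mathcal{F}'$, $b\in\mathscr{A}$, either $b\cap a^*=\emptyset$ or $b\subseteq a^*$. $\mathcal{F}$ is a 2-thin Kurepa family with respect to $S$ if $\mathcal{F}\subseteq\bigcup\{[\mathcal{X}_{s,n}]^{\omega_1}:s\in S,0<n<\omega\}$ and: (i) for every $\alpha<\omega_1$, $|\{\mathscr{A}\cap[S\upharpoonright\alpha]^{<\omega}:\mathscr{A}\in\mathcal{F}\}|\le\omega$;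 (ii) for every $s\in S$, $0<n<\omega$ and every uncountable pairwise disjoint $\mathscr{A}\subseteq\mathcal{X}_{s,n}$ there is $\mathscr{B}\in\mathcal{F}$ with $|\mathscr{A}\cap\mathscr{B}|=\omega_1$; (iii) for every $a\in[S]^{<\omega}$ and $\mathcal{F}'\in[\mathcal{F}]^{<\omega}$, $cl(a,\mathcal{F}')$ is finite; (iv) every $\mathscr{A}\in\mathcal{F}$ is non-overlapping. For a coloring $c:[S]^2\to2$, $c(x,y)$ denotes $c(\{x,y\})$. The properties of $c$ (relative to $\mathcal{F}$) are: (coh) for all $s<_St$ in $S$, $\{x<_Ss:c(x,s)\ne c(x,t)\}$ is finite; (hom) for every $\alpha<\omega_1$, $s\in S\upharpoonright\alpha$, $0<n<\omega$, $\mathscr{A}\in\mathcal{F}\cap[\mathcal{X}_{s,n}]^{\omega_1}$ and $a\in[S_\alpha]^2$ with $D_{a(0),a(1)}=\{ht(s)\}$, for all but finitely many $b\in\mathscr{A}\cap[S\upharpoonright\alpha]^{<\omega}$ there is $i<2$ such that if $b(2n-1)<_Sa(1)$ then $c(b(j),a(0))=i$ and $c(b(n+j),a(1))=1-i$ for all $j<n$. *)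

theory Defs
  imports Complex_Main "HOL-Library.Countable_Set" "HOL-Library.Disjoint_Sets"
    "HOL-Library.Equipollence"
begin

text \<open>
  The ordinal \<open>\<omega>\<^sub>1\<close> is the well-ordered field of the successor cardinal of \<open>\<aleph>\<^sub>0\<close>.  Countable ordinals
  are the elements of this type; the von Neumann ordinal \<open>\<alpha>\<close> is the initial segment \<open>{..<\<alpha>}\<close>.
\<close>

typedef omega1 = "Field (cardSuc natLeq)"
proof -
  have "infinite (Field (cardSuc natLeq))"
    using cardSuc_finite[OF natLeq_Card_order] by (simp add: Field_natLeq)
  then show ?thesis by (metis ex_in_conv finite.emptyI)
qed

lemma cardSuc_natLeq_Well_order: "Well_order (cardSuc natLeq)"
  using cardSuc_Card_order[OF natLeq_Card_order] card_order_on_well_order_on by blast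

instantiation omega1 :: wellorder
begin

definition less_eq_omega1 :: "omega1 \<Rightarrow> omega1 \<Rightarrow> bool"
  where "x \<le> y \<longleftrightarrow> (Rep_omega1 x, Rep_omega1 y) \<in> cardSuc natLeq"

definition less_omega1 :: "omega1 \<Rightarrow> omega1 \<Rightarrow> bool"
  where "(x :: omega1) < y \<longleftrightarrow> x \<le> y \<and> x \<noteq> y"

instance
proof -
  let ?r = "cardSuc natLeq"
  have refl: "Refl ?r" and trans: "trans ?r" and anti: "antisym ?r" and tot: "Total ?r"
    and wf: "wf (?r - Id)"
    using cardSuc_natLeq_Well_order
    by (auto simp: well_order_on_def linear_order_on_def partial_order_on_def preorder_on_def)
  have R: "x \<le> x" for x :: omega1
    using refl Rep_omega1[of x] by (auto simp: less_eq_omega1_def refl_on_def)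
  have A: "x = y" if "x \<le> y" "y \<le> x" for x y :: omega1
    using anti that unfolding less_eq_omega1_def by (meson Rep_omega1_inject antisymD)
  have T: "x \<le> z" if "x \<le> y" "y \<le> z" for x y z :: omega1
    using trans that unfolding less_eq_omega1_def by (meson transD)
  have L: "x \<le> y \<or> y \<le> x" for x y :: omega1
  proof (cases "x = y")
    case False
    then show ?thesis
      using tot Rep_omega1[of x] Rep_omega1[of y]
      by (auto simp: less_eq_omega1_def total_on_def Rep_omega1_inject)
  qed (simp add: R)
  have W: "P a" if step: "\<And>x. (\<And>y. y < x \<Longrightarrow> P y) \<Longrightarrow> P x" for P and a :: omega1
  proof -
    have "wf (inv_image (?r - Id) Rep_omega1)"
      using wf by simp
    moreover have "inv_image (?r - Id) Rep_omega1 = {(x, y). x < y}"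
      by (auto simp: inv_image_def less_omega1_def less_eq_omega1_def Rep_omega1_inject)
    ultimately show ?thesis
      using step by (metis (no_types, lifting) case_prodI mem_Collect_eq wf_induct)
  qed
  show "OFCLASS(omega1, wellorder_class)"
  proof
    fix x y z :: omega1
    show "x < y \<longleftrightarrow> x \<le> y \<and> \<not> y \<le> x"
      using A R by (auto simp: less_omega1_def)
    show "x \<le> x" by (rule R)
    show "x \<le> y \<Longrightarrow> y \<le> z \<Longrightarrow> x \<le> z" by (rule T)
    show "x \<le> y \<Longrightarrow> y \<le> x \<Longrightarrow> x = y" by (rule A)
    show "x \<le> y \<or> y \<le> x" by (rule L)
  next
    fix P :: "omega1 \<Rightarrow> bool" and a :: omega1
    assume "\<And>x. (\<And>y. y < x \<Longrightarrow> P y) \<Longrightarrow> P x"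
    then show "P a" by (rule W)
  qed
qed

end

lemma uncountable_omega1: "\<not> countable (UNIV :: omega1 set)"
proof
  assume "countable (UNIV :: omega1 set)"
  then have "countable (Field (cardSuc natLeq))"
    by (metis type_definition.Rep_range[OF type_definition_omega1] countable_image)
  then obtain f :: "nat set \<Rightarrow> nat" where "inj_on f (Field (cardSuc natLeq))"
    by (auto simp: countable_def)
  then have "ordLeq3 (card_of (Field (cardSuc natLeq))) (card_of (UNIV :: nat set))"
    using card_of_ordLeq by blast
  then have "ordLeq3 (cardSuc natLeq) natLeq"
    using card_of_Field_ordIso[OF cardSuc_Card_order[OF natLeq_Card_order]] card_of_nat
    by (meson ordIso_ordLeq_trans ordIso_symmetric ordLeq_ordIso_trans)
  then show False
    using cardSuc_greater[OF natLeq_Card_order] not_ordLeq_ordLess by blast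
qed

lemma countable_lessThan_omega1: "countable {..<\<alpha> :: omega1}"
proof -
  let ?r = "cardSuc natLeq"
  have "ordLess2 (card_of (underS ?r (Rep_omega1 \<alpha>))) ?r"
    using card_of_underS[OF cardSuc_Card_order[OF natLeq_Card_order] Rep_omega1] .
  then have "ordLeq3 (card_of (underS ?r (Rep_omega1 \<alpha>))) natLeq"
    using cardSuc_ordLeq_ordLess[OF natLeq_Card_order card_of_Card_order] by blast
  then have "ordLeq3 (card_of (underS ?r (Rep_omega1 \<alpha>))) (card_of (UNIV :: nat set))"
    using card_of_nat by (meson ordIso_symmetric ordLeq_ordIso_trans)
  then have "countable (underS ?r (Rep_omega1 \<alpha>))"
    unfolding card_of_ordLeq[symmetric] countable_def by blast
  moreover have "Rep_omega1 ` {..<\<alpha>} \<subseteq> underS ?r (Rep_omega1 \<alpha>)"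
    by (auto simp: underS_def less_omega1_def less_eq_omega1_def Rep_omega1_inject)
  ultimately have "countable (Rep_omega1 ` {..<\<alpha>})"
    by (rule countable_subset[rotated])
  moreover have "inj_on Rep_omega1 {..<\<alpha>}"
    by (simp add: inj_on_def Rep_omega1_inject)
  ultimately show ?thesis
    by (rule countable_image_inj_on)
qed

definition card_omega1 :: "'a set \<Rightarrow> bool"
  where "card_omega1 A \<longleftrightarrow> A \<approx> (UNIV :: omega1 set)"

text \<open>
  The set \<open>2 = {0, 1}\<close> is rendered as \<^typ>\<open>bool\<close>, with 0 as \<^const>\<open>False\<close> and 1 as \<^const>\<open>True\<close>
  (so \<open>1 - i\<close> is \<open>\<not> i\<close>), and a function from \<open>\<alpha>\<close> to 2 as a map with domain \<open>{..<\<alpha>}\<close>.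
\<close>

type_synonym seq = "omega1 \<rightharpoonup> bool"

definition binseqs :: "seq set"
  where "binseqs = {t. \<exists>\<alpha>. dom t = {..<\<alpha>}}"

definition ht :: "seq \<Rightarrow> omega1"
  where "ht t = (THE \<alpha>. dom t = {..<\<alpha>})"

definition seq_less :: "seq \<Rightarrow> seq \<Rightarrow> bool"  (infix "\<sqsubset>" 50)
  where "s \<sqsubset> t \<longleftrightarrow> s \<subseteq>\<^sub>m t \<and> s \<noteq> t"

definition level :: "seq set \<Rightarrow> omega1 \<Rightarrow> seq set"
  where "level S \<alpha> = {t \<in> S. ht t = \<alpha>}"

definition below :: "seq set \<Rightarrow> omega1 \<Rightarrow> seq set"
  where "below S \<alpha> = (\<Union>\<beta><\<alpha>. level S \<beta>)"

definition is_chain :: "seq set \<Rightarrow> bool"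
  where "is_chain C \<longleftrightarrow> (\<forall>s\<in>C. \<forall>t\<in>C. s \<noteq> t \<longrightarrow> s \<sqsubset> t \<or> t \<sqsubset> s)"

definition is_antichain :: "seq set \<Rightarrow> bool"
  where "is_antichain C \<longleftrightarrow> (\<forall>s\<in>C. \<forall>t\<in>C. s \<noteq> t \<longrightarrow> \<not> s \<sqsubset> t \<and> \<not> t \<sqsubset> s)"

definition suslin_tree :: "seq set \<Rightarrow> bool"
  where "suslin_tree S \<longleftrightarrow>
    S \<subseteq> binseqs \<and> uncountable S \<and>
    (\<forall>t\<in>S. \<forall>\<alpha>\<le>ht t. t |` {..<\<alpha>} \<in> S) \<and>
    (\<forall>C\<subseteq>S. is_chain C \<longrightarrow> countable C) \<and>
    (\<forall>C\<subseteq>S. is_antichain C \<longrightarrow> countable C)"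

definition Delta :: "seq \<Rightarrow> seq \<Rightarrow> omega1"
  where "Delta s t =
    (GREATEST \<alpha>. \<alpha> \<le> min (ht s) (ht t) \<and> s |` {..<\<alpha>} = t |` {..<\<alpha>})"

definition Dset :: "seq \<Rightarrow> seq \<Rightarrow> omega1 set"
  where "Dset s t = {\<xi>. \<xi> < min (ht s) (ht t) \<and> s \<xi> \<noteq> t \<xi>}"

definition coherent :: "seq set \<Rightarrow> bool"
  where "coherent S \<longleftrightarrow> (\<forall>s\<in>S. \<forall>t\<in>S. finite (Dset s t))"

definition complete_coherent :: "seq set \<Rightarrow> bool"
  where "complete_coherent S \<longleftrightarrow> coherent S \<and>
    (\<forall>s\<in>S. \<forall>t. dom t = {..<ht s} \<and> finite (Dset s t) \<longrightarrow> t \<in> S)"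

definition ho_less :: "seq \<Rightarrow> seq \<Rightarrow> bool"
  where "ho_less s t \<longleftrightarrow> s \<noteq> t \<and>
    (ht s < ht t \<or> ht s = ht t \<and> the (s (Delta s t)) < the (t (Delta s t)))"

text \<open>
  For a finite set \<open>a\<close> of binary sequences, \<open>el a i\<close> is \<open>a(i)\<close>, the \<open>i\<close>-th element of \<open>a\<close>
  in the height order.  The list is unique because \<^const>\<open>ho_less\<close> is a strict linear order
  on \<^const>\<open>binseqs\<close>; irreflexivity forces it to be free of repetitions.
\<close>

definition el :: "seq set \<Rightarrow> nat \<Rightarrow> seq"
  where "el a i = (THE xs. set xs = a \<and> sorted_wrt ho_less xs) ! i"

definition Xfam :: "seq set \<Rightarrow> seq \<Rightarrow> nat \<Rightarrow> seq set set"
  where "Xfam S s n = {a. a \<subseteq> S \<and> finite a \<and> card a = 2 * n \<and>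
    s(ht s \<mapsto> False) \<sqsubset> el a 0 \<and> (\<forall>i. Suc i < n \<longrightarrow> el a i \<sqsubset> el a (Suc i)) \<and>
    s(ht s \<mapsto> True) \<sqsubset> el a n \<and> (\<forall>i. Suc i < n \<longrightarrow> el a (n + i) \<sqsubset> el a (n + Suc i)) \<and>
    ht (el a (n - 1)) < ht (el a n) \<and> Dset (el a (n - 1)) (el a n) = {ht s}}"

text \<open>Only used for families of nonempty finite sets, so that the extrema exist.\<close>

definition non_overlapping :: "seq set set \<Rightarrow> bool"
  where "non_overlapping A \<longleftrightarrow> (\<forall>a\<in>A. \<forall>b\<in>A. a \<noteq> b \<longrightarrow>
    Max (ht ` a) < Min (ht ` b) \<or> Max (ht ` b) < Min (ht ` a))"

definition cl :: "seq set \<Rightarrow> seq set \<Rightarrow> seq set set set \<Rightarrow> seq set"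
  where "cl S a F' = (LEAST a'. a \<subseteq> a' \<and> a' \<subseteq> S \<and>
    (\<forall>A\<in>F'. \<forall>b\<in>A. b \<inter> a' = {} \<or> b \<subseteq> a'))"

definition kurepa_family :: "seq set \<Rightarrow> seq set set set \<Rightarrow> bool"
  where "kurepa_family S F \<longleftrightarrow>
    (\<forall>A\<in>F. \<exists>s\<in>S. \<exists>n>0. A \<subseteq> Xfam S s n \<and> card_omega1 A) \<and>
    (\<forall>\<alpha>. countable {A \<inter> {a. finite a \<and> a \<subseteq> below S \<alpha>} |A. A \<in> F}) \<and>
    (\<forall>s\<in>S. \<forall>n>0. \<forall>A. A \<subseteq> Xfam S s n \<and> uncountable A \<and> disjoint A \<longrightarrow>
       (\<exists>B\<in>F. card_omega1 (A \<inter> B))) \<and>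
    (\<forall>a F'. finite a \<and> a \<subseteq> S \<and> finite F' \<and> F' \<subseteq> F \<longrightarrow> finite (cl S a F')) \<and>
    (\<forall>A\<in>F. non_overlapping A)"

text \<open>A coloring of the pairs from \<open>S\<close> is a total function on sets; its values elsewhere are never used.\<close>

definition coh :: "seq set \<Rightarrow> (seq set \<Rightarrow> bool) \<Rightarrow> bool"
  where "coh S c \<longleftrightarrow> (\<forall>s\<in>S. \<forall>t\<in>S. s \<sqsubset> t \<longrightarrow>
    finite {x \<in> S. x \<sqsubset> s \<and> c {x, s} \<noteq> c {x, t}})"

definition hom_property :: "seq set \<Rightarrow> seq set set set \<Rightarrow> (seq set \<Rightarrow> bool) \<Rightarrow> bool"
  where "hom_property S F c \<longleftrightarrow>
    (\<forall>\<alpha>. \<forall>s\<in>below S \<alpha>. \<forall>n>0. \<forall>A\<in>F. \<forall>a. A \<subseteq> Xfam S s n \<and> card_omega1 A \<and>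
       a \<subseteq> level S \<alpha> \<and> card a = 2 \<and> Dset (el a 0) (el a 1) = {ht s} \<longrightarrow>
       finite {b \<in> A. finite b \<and> b \<subseteq> below S \<alpha> \<and>
         \<not> (\<exists>i. el b (2 * n - 1) \<sqsubset> el a 1 \<longrightarrow>
              (\<forall>j<n. c {el b j, el a 0} = i \<and> c {el b (n + j), el a 1} = (\<not> i)))})"

end

theory Submission
  imports Defs
begin

text \<open>
  Heights may be assumed to separate the members of \<open>A\<close>, and by the guessing property of \<open>F\<close> all
  \<open>a \<in> \<Union>A\<close> may be assumed to lie in finitely many families from \<open>F\<close>.  Fix \<open>y \<in> A\<close> and let \<open>\<alpha>\<close> be its
  minimal height.  Applying (hom) at level \<open>\<alpha>\<close> and then (coh), only finitely many \<open>x \<in> A\<close> below \<open>\<alpha>\<close>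
  contain an \<open>a\<close> that violates the conclusion with some \<open>b \<in> y\<close>.  So every \<open>y\<close> has finitely many bad
  predecessors, the graph of bad pairs has a greedy colouring with countably many colours, and some
  colour class is uncountable.
\<close>

section \<open>Sorted enumerations\<close>

text \<open>By induction, a new element is placed between the elements related to it and those it is
  related to. The order axioms are asked for on \<open>A\<close> only, since \<open>ho_less\<close>
  is shown to be linear just on \<open>binseqs\<close>.\<close>

lemma ex_sorted_wrt_list:
  assumes "finite A" "\<And>x y z. x \<in> A \<Longrightarrow> y \<in> A \<Longrightarrow> z \<in> A \<Longrightarrow> R x y \<Longrightarrow> R y z \<Longrightarrow> R x z"
    and "\<And>x y. x \<in> A \<Longrightarrow> y \<in> A \<Longrightarrow> x \<noteq> y \<Longrightarrow> R x y \<or> R y x"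
  shows "\<exists>xs. set xs = A \<and> sorted_wrt R xs"
  using assms
proof (induction A rule: finite_induct)
  case empty
  then show ?case by simp
next
  case (insert x A)
  obtain xs where xs: "set xs = A" "sorted_wrt R xs"
  proof -
    have "\<exists>xs. set xs = A \<and> sorted_wrt R xs"
      by (rule insert.IH) (use insert.prems in \<open>blast+\<close>)
    then show ?thesis using that by blast
  qed
  let ?ys = "filter (\<lambda>y. R y x) xs @ x # filter (\<lambda>y. R x y) xs"
  have "set ?ys = insert x A"
    using insert.hyps(2) insert.prems(2)[of x] xs(1) by auto
  moreover have "R y z" if "y \<in> A" "z \<in> A" "R y x" "R x z" for y z
    using insert.prems(1)[of y x z] that by blast
  then have "sorted_wrt R ?ys"
    using xs by (simp add: sorted_wrt_append sorted_wrt_filter)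
  ultimately show ?case by blast
qed

text \<open>Different heads would each be related to the other, against asymmetry. Irreflexivity
  keeps the common head out of both tails, so the tails have equal sets and induction
  applies.\<close>

lemma sorted_wrt_list_unique:
  assumes "sorted_wrt R xs" "sorted_wrt R ys" "set xs = set ys"
    and "\<And>x y. x \<in> set xs \<Longrightarrow> y \<in> set xs \<Longrightarrow> R x y \<Longrightarrow> \<not> R y x"
  shows "xs = ys"
  using assms
proof (induction xs arbitrary: ys)
  case Nil
  show ?case using Nil.prems(3) by simp
next
  case (Cons x xs)
  obtain y zs where ys: "ys = y # zs" using Cons.prems(3) by (cases ys) simp_all
  have irr: "\<not> R z z" if "z \<in> set (x # xs)" for z using Cons.prems(4) that by blast
  have xy: "x = y"
  proof (rule ccontr)
    assume "x \<noteq> y"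
    then have "R x y" "R y x" using Cons.prems(1,2,3) ys by auto
    then show False using Cons.prems(3,4) ys by (metis list.set_intros(1))
  qed
  have "x \<notin> set xs" "x \<notin> set zs"
    using irr[of x] Cons.prems(1,2) ys xy by auto
  then have "set xs = set zs" using Cons.prems(3) ys xy by auto
  moreover have "sorted_wrt R xs" "sorted_wrt R zs" using Cons.prems(1,2) ys by simp_all
  moreover have "\<not> R z w" if "w \<in> set xs" "z \<in> set xs" "R w z" for w z
    using Cons.prems(4)[of w z] that by simp
  ultimately show ?case using Cons.IH[of zs] ys xy by blast
qed

section \<open>Binary sequences and the height order\<close>

lemma ht_eqI: "dom t = {..<\<alpha>} \<Longrightarrow> ht t = \<alpha>"
  unfolding ht_def by (rule the_equality) auto

lemma dom_binseq: "t \<in> binseqs \<Longrightarrow> dom t = {..<ht t}"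
  using ht_eqI by (auto simp: binseqs_def)

lemma binseq_None_iff: "t \<in> binseqs \<Longrightarrow> t \<xi> = None \<longleftrightarrow> ht t \<le> \<xi>"
  using dom_binseq[of t] domIff[of \<xi> t] by (metis lessThan_iff not_less)

lemma dom_restrict_binseq: "t \<in> binseqs \<Longrightarrow> \<alpha> \<le> ht t \<Longrightarrow> dom (t |` {..<\<alpha>}) = {..<\<alpha>}"
  using dom_binseq[of t] by auto

lemma ht_restrict_binseq: "t \<in> binseqs \<Longrightarrow> \<alpha> \<le> ht t \<Longrightarrow> ht (t |` {..<\<alpha>}) = \<alpha>"
  using dom_restrict_binseq ht_eqI by blast

lemma map_le_ht: "s \<in> binseqs \<Longrightarrow> t \<in> binseqs \<Longrightarrow> s \<subseteq>\<^sub>m t \<Longrightarrow> ht s \<le> ht t"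
  using map_le_implies_dom_le[of s t] dom_binseq by auto

lemma map_leD_binseq: "s \<in> binseqs \<Longrightarrow> s \<subseteq>\<^sub>m t \<Longrightarrow> \<xi> < ht s \<Longrightarrow> s \<xi> = t \<xi>"
  using dom_binseq[of s] by (auto simp: map_le_def)

lemma map_leI_binseq: "s \<in> binseqs \<Longrightarrow> (\<And>\<xi>. \<xi> < ht s \<Longrightarrow> s \<xi> = t \<xi>) \<Longrightarrow> s \<subseteq>\<^sub>m t"
  using dom_binseq[of s] by (auto simp: map_le_def)

lemma seq_less_ht:
  assumes "s \<in> binseqs" "t \<in> binseqs" "s \<sqsubset> t"
  shows "ht s < ht t"
proof (rule ccontr)
  assume "\<not> ht s < ht t"
  then have "dom s = dom t"
    using map_le_ht[of s t] assms dom_binseq[of s] dom_binseq[of t] by (auto simp: seq_less_def)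
  then have "s = t"
    using assms(3) by (auto simp: seq_less_def map_le_def fun_eq_iff domIff) (metis domIff)
  then show False using assms(3) by (simp add: seq_less_def)
qed

lemma Delta_eqI:
  assumes "\<xi> < min (ht s) (ht t)" "s \<xi> \<noteq> t \<xi>" "\<And>\<eta>. \<eta> < \<xi> \<Longrightarrow> s \<eta> = t \<eta>"
  shows "Delta s t = \<xi>"
  unfolding Delta_def
proof (rule Greatest_equality)
  show "\<xi> \<le> min (ht s) (ht t) \<and> s |` {..<\<xi>} = t |` {..<\<xi>}"
    using assms by (auto simp: restrict_map_def fun_eq_iff)
next
  fix \<alpha> assume a: "\<alpha> \<le> min (ht s) (ht t) \<and> s |` {..<\<alpha>} = t |` {..<\<alpha>}"
  show "\<alpha> \<le> \<xi>"
  proof (rule ccontr)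
    assume "\<not> \<alpha> \<le> \<xi>"
    moreover have "(s |` {..<\<alpha>}) \<xi> = (t |` {..<\<alpha>}) \<xi>" using a by simp
    ultimately have "s \<xi> = t \<xi>" by simp
    then show False using assms(2) by simp
  qed
qed

text \<open>At equal heights \<open>Delta\<close> is the first place of difference, and the smaller
  sequence has value 0 there. This form, free of \<open>Delta\<close> and \<open>the\<close>, yields
  the order axioms.\<close>

lemma ho_less_iff:
  assumes "s \<in> binseqs" "t \<in> binseqs"
  shows "ho_less s t \<longleftrightarrow> ht s < ht t \<or> ht s = ht t \<and>
    (\<exists>\<xi><ht s. s \<xi> = Some False \<and> t \<xi> = Some True \<and> (\<forall>\<eta><\<xi>. s \<eta> = t \<eta>))" (is "_ \<longleftrightarrow> ?R")
proof
  assume ho: "ho_less s t"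
  show ?R
  proof (cases "ht s < ht t")
    case False
    then have h: "ht s = ht t" "s \<noteq> t" "the (s (Delta s t)) < the (t (Delta s t))"
      using ho by (auto simp: ho_less_def)
    define \<xi> where "\<xi> = (LEAST \<xi>. s \<xi> \<noteq> t \<xi>)"
    have ne: "s \<xi> \<noteq> t \<xi>" unfolding \<xi>_def by (rule LeastI_ex) (use h(2) in auto)
    have eq: "\<And>\<eta>. \<eta> < \<xi> \<Longrightarrow> s \<eta> = t \<eta>" unfolding \<xi>_def using not_less_Least by blast
    have lt: "\<xi> < ht s"
      \<comment> \<open>At and beyond the common height both sequences are undefined, hence
        equal.\<close>
      using ne binseq_None_iff[of s \<xi>] binseq_None_iff[of t \<xi>] assms h(1) by (metis not_less)
    have "Delta s t = \<xi>" using Delta_eqI lt h(1) ne eq by simp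
    moreover have "s \<xi> \<noteq> None" "t \<xi> \<noteq> None"
      using lt h(1) assms binseq_None_iff by auto
    ultimately have "s \<xi> = Some False \<and> t \<xi> = Some True" using h(3) by auto
    then show ?thesis using lt h(1) eq by blast
  qed simp
next
  assume R: ?R
  show "ho_less s t"
  proof (cases "ht s < ht t")
    case False
    then obtain \<xi> where x: "ht s = ht t" "\<xi> < ht s" "s \<xi> = Some False" "t \<xi> = Some True"
      "\<forall>\<eta><\<xi>. s \<eta> = t \<eta>" using R by auto
    then have "Delta s t = \<xi>" by (intro Delta_eqI) auto
    then show ?thesis using x by (auto simp: ho_less_def)
  qed (auto simp: ho_less_def)
qed

lemma ho_less_asym: "s \<in> binseqs \<Longrightarrow> t \<in> binseqs \<Longrightarrow> ho_less s t \<Longrightarrow> \<not> ho_less t s"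
  by (auto simp: ho_less_iff) (metis linorder_neqE option.inject)

text \<open>At equal heights the two first differences are distinct, because \<open>t\<close> has
  value 1 at one and 0 at the other; the smaller one is the first difference of \<open>s\<close> and
  \<open>r\<close>.\<close>

lemma ho_less_trans:
  assumes "s \<in> binseqs" "t \<in> binseqs" "r \<in> binseqs" "ho_less s t" "ho_less t r"
  shows "ho_less s r"
proof (cases "ht s < ht t \<or> ht t < ht r")
  case True
  then show ?thesis using assms by (auto simp: ho_less_iff)
next
  case False
  then obtain \<xi> \<zeta> where h: "ht s = ht t" "ht t = ht r"
    and x: "\<xi> < ht s" "s \<xi> = Some False" "t \<xi> = Some True" "\<forall>\<eta><\<xi>. s \<eta> = t \<eta>"
    and z: "\<zeta> < ht s" "t \<zeta> = Some False" "r \<zeta> = Some True" "\<forall>\<eta><\<zeta>. t \<eta> = r \<eta>"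
    using assms by (auto simp: ho_less_iff)
  have "\<xi> \<noteq> \<zeta>" using x z by auto
  then have "s (min \<xi> \<zeta>) = Some False \<and> r (min \<xi> \<zeta>) = Some True"
    using x z by (cases "\<xi> < \<zeta>") (auto simp: min_def)
  moreover have "\<forall>\<eta><min \<xi> \<zeta>. s \<eta> = r \<eta>" "min \<xi> \<zeta> < ht s"
    using x z by (auto simp: min_less_iff_disj)
  ultimately show ?thesis using h assms by (auto simp: ho_less_iff)
qed

lemma ho_less_total:
  assumes "s \<in> binseqs" "t \<in> binseqs" "s \<noteq> t"
  shows "ho_less s t \<or> ho_less t s"
proof (cases "ht s = ht t")
  case True
  define \<xi> where "\<xi> = (LEAST \<xi>. s \<xi> \<noteq> t \<xi>)"
  have ne: "s \<xi> \<noteq> t \<xi>" unfolding \<xi>_def by (rule LeastI_ex) (use assms(3) in auto)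
  have eq: "\<And>\<eta>. \<eta> < \<xi> \<Longrightarrow> s \<eta> = t \<eta>" unfolding \<xi>_def using not_less_Least by blast
  have lt: "\<xi> < ht s"
    using ne binseq_None_iff[of s \<xi>] binseq_None_iff[of t \<xi>] assms True by (metis not_less)
  then have "s \<xi> \<noteq> None" "t \<xi> \<noteq> None"
    using True assms binseq_None_iff by auto
  then have "s \<xi> = Some False \<and> t \<xi> = Some True \<or> s \<xi> = Some True \<and> t \<xi> = Some False"
    using ne by auto
  then show ?thesis using True lt eq assms by (auto simp: ho_less_iff)
qed (use assms in \<open>auto simp: ho_less_iff neq_iff\<close>)

section \<open>Enumeration of finite sets in the height order\<close>

lemma el_eq_nth:
  assumes "a \<subseteq> binseqs" "set xs = a" "sorted_wrt ho_less xs"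
  shows "el a i = xs ! i"
proof -
  have "(THE xs. set xs = a \<and> sorted_wrt ho_less xs) = xs"
  proof (rule the_equality)
    fix ys assume "set ys = a \<and> sorted_wrt ho_less ys"
    then show "ys = xs"
      using sorted_wrt_list_unique[of ho_less ys xs] ho_less_asym assms by blast
  qed (use assms in simp)
  then show ?thesis by (simp add: el_def)
qed

lemma el_image:
  assumes "a \<subseteq> binseqs" "finite a"
  shows "el a ` {..<card a} = a"
proof -
  have "\<exists>xs. set xs = a \<and> sorted_wrt ho_less xs"
  proof (rule ex_sorted_wrt_list[OF assms(2)])
    show "ho_less x z" if "x \<in> a" "y \<in> a" "z \<in> a" "ho_less x y" "ho_less y z" for x y z
      using ho_less_trans[of x y z] that assms(1) by blast
    show "ho_less x y \<or> ho_less y x" if "x \<in> a" "y \<in> a" "x \<noteq> y" for x y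
      using ho_less_total[of x y] that assms(1) by blast
  qed
  then obtain xs where xs: "set xs = a" "sorted_wrt ho_less xs" by blast
  have "xs ! i \<noteq> xs ! j" if "i < j" "j < length xs" for i j
    using sorted_wrt_nth_less[OF xs(2) that] by (auto simp: ho_less_def)
  then have "distinct xs"
    unfolding distinct_conv_nth by (metis linorder_neqE_nat)
  then have "card a = length xs" using xs(1) distinct_card by blast
  then show ?thesis
    using el_eq_nth[OF assms(1) xs] xs(1) by (auto simp: set_conv_nth)
qed

lemma el_pair:
  assumes "u \<in> binseqs" "v \<in> binseqs" "ho_less u v"
  shows "el {u, v} 0 = u" "el {u, v} 1 = v"
  using el_eq_nth[of "{u, v}" "[u, v]" 0] el_eq_nth[of "{u, v}" "[u, v]" 1] assms by simp_all

section \<open>Countable ordinals and uncountable sets\<close>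

text \<open>Otherwise the countably many countable initial segments up to points of \<open>C\<close>
  would cover \<omega>1.\<close>

lemma omega1_countable_bound:
  fixes C :: "omega1 set"
  assumes "countable C"
  shows "\<exists>\<beta>. \<forall>\<gamma>\<in>C. \<gamma> < \<beta>"
proof (rule ccontr)
  assume "\<not> ?thesis"
  then have "UNIV = (\<Union>\<gamma>\<in>C. {..\<gamma>})" by (auto simp: not_less)
  moreover have "countable {..\<gamma>}" for \<gamma> :: omega1
    using countable_lessThan_omega1[of \<gamma>] ivl_disj_un_singleton(2)[of \<gamma>]
    by (metis countable_Un countable_empty countable_insert)
  ultimately show False using uncountable_omega1 countable_UN[OF assms, of atMost] by simp
qed

lemma card_omega1_uncountable: "card_omega1 A \<Longrightarrow> uncountable A"
  using uncountable_omega1 by (metis card_omega1_def countable_eqpoll eqpoll_sym)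

lemma omega1_lepoll_uncountable:
  fixes A :: "'a set"
  assumes "uncountable A"
  shows "(UNIV :: omega1 set) \<lesssim> A"
proof -
  have "\<not> ordLeq3 (card_of A) natLeq"
  proof
    assume "ordLeq3 (card_of A) natLeq"
    then have "ordLeq3 (card_of A) (card_of (UNIV :: nat set))"
      using card_of_nat by (meson ordIso_symmetric ordLeq_ordIso_trans)
    then show False using assms unfolding card_of_ordLeq[symmetric] countable_def by blast
  qed
  then have "ordLess2 natLeq (card_of A)"
    using not_ordLeq_iff_ordLess[OF natLeq_Well_order card_of_Well_order] by blast
  then have "ordLeq3 (cardSuc natLeq) (card_of A)"
    using cardSuc_least[OF natLeq_Card_order card_of_Card_order] by blast
  then have "ordLeq3 (card_of (Field (cardSuc natLeq))) (card_of A)"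
    using card_of_Field_ordIso[OF cardSuc_Card_order[OF natLeq_Card_order]]
    by (meson ordIso_ordLeq_trans)
  then obtain f where f: "inj_on f (Field (cardSuc natLeq))" "f ` Field (cardSuc natLeq) \<subseteq> A"
    unfolding card_of_ordLeq[symmetric] by blast
  have "inj (f \<circ> Rep_omega1)" "range (f \<circ> Rep_omega1) \<subseteq> A"
    using f Rep_omega1 by (auto simp: inj_on_def Rep_omega1_inject[symmetric])
  then show ?thesis unfolding lepoll_def by blast
qed

text \<open>An uncountable set has size at least \<omega>1, and \<open>h\<close> gives the upper
  bound. In the application \<open>h\<close> is the minimal height, so no cardinality of families
  over \<open>S\<close> has to be computed.\<close>

lemma card_omega1I:
  fixes h :: "'a \<Rightarrow> omega1"
  assumes "uncountable A" "inj_on h A"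
  shows "card_omega1 A"
  unfolding card_omega1_def
  using omega1_lepoll_uncountable[OF assms(1)] assms(2)
  by (intro lepoll_antisym) (auto simp: lepoll_def)

text \<open>Zorn's lemma gives a maximal subset of \<open>A\<close> pairwise related by
  \<open>R\<close>; if it were countable, the hypothesis would extend it. This replaces a recursion
  of length \<omega>1.\<close>

lemma uncountable_pairwise_subset:
  assumes "symp R" "\<And>C. C \<subseteq> A \<Longrightarrow> countable C \<Longrightarrow> \<exists>x\<in>A - C. \<forall>y\<in>C. R x y"
  shows "\<exists>B\<subseteq>A. uncountable B \<and> pairwise R B"
proof -
  let ?P = "{B. B \<subseteq> A \<and> pairwise R B}"
  have "\<exists>M\<in>?P. \<forall>X\<in>?P. M \<subseteq> X \<longrightarrow> X = M"
  proof (rule subset_Zorn')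
    fix C assume C: "subset.chain ?P C"
    have "pairwise R (\<Union>C)"
      unfolding pairwise_def
    proof clarify
      fix x X y Y assume h: "x \<in> X" "X \<in> C" "y \<in> Y" "Y \<in> C" "x \<noteq> y"
      then have "X \<subseteq> Y \<or> Y \<subseteq> X" using C by (auto simp: subset_chain_def)
      moreover have "pairwise R X" "pairwise R Y" using C h by (auto simp: subset_chain_def)
      ultimately show "R x y" using h by (auto simp: pairwise_def)
    qed
    then show "\<Union>C \<in> ?P" using C by (auto simp: subset_chain_def)
  qed
  then obtain M where M: "M \<subseteq> A" "pairwise R M"
    and max: "\<And>X. X \<subseteq> A \<Longrightarrow> pairwise R X \<Longrightarrow> M \<subseteq> X \<Longrightarrow> X = M" by auto
  have "uncountable M"
  proof
    assume "countable M"
    then obtain x where x: "x \<in> A - M" "\<forall>y\<in>M. R x y" using assms(2) M(1) by blast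
    then have "pairwise R (insert x M)"
      using M(2) sympD[OF assms(1)] by (auto simp: pairwise_insert)
    then show False using max[of "insert x M"] x M(1) by auto
  qed
  then show ?thesis using M by blast
qed

text \<open>Greedy colouring: every vertex avoids the finitely many colours of its predecessors.\<close>

lemma uncountable_free_subset:
  fixes h :: "'a \<Rightarrow> 'b::wellorder"
  assumes "uncountable V" "\<And>y. y \<in> V \<Longrightarrow> finite {x \<in> V. h x < h y \<and> E x y}"
  shows "\<exists>B\<subseteq>V. uncountable B \<and> (\<forall>x\<in>B. \<forall>y\<in>B. h x < h y \<longrightarrow> \<not> E x y)"
proof -
  let ?R = "inv_image {(a, b). a < b} h"
  let ?N = "\<lambda>y. {x \<in> V. h x < h y \<and> E x y}"
  have "\<exists>col :: 'a \<Rightarrow> nat. \<forall>y. (y \<in> V \<longrightarrow> col y \<notin> col ` ?N y)"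
  \<comment> \<open>The constraint on the colour of a vertex involves only vertices of smaller
    \<open>h\<close>, so colours can be chosen by well-founded recursion.\<close>
  proof (rule dependent_wf_choice[where R = ?R and P = "\<lambda>f y k. y \<in> V \<longrightarrow> k \<notin> f ` ?N y"])
    show "wf ?R" by (intro wf_inv_image wf)
  next
    fix f g :: "'a \<Rightarrow> nat" and x r assume "\<And>z. (z, x) \<in> ?R \<Longrightarrow> f z = g z"
    then have "f ` ?N x = g ` ?N x" by (intro image_cong) auto
    then show "(x \<in> V \<longrightarrow> r \<notin> f ` ?N x) = (x \<in> V \<longrightarrow> r \<notin> g ` ?N x)" by simp
  next
    fix x and f :: "'a \<Rightarrow> nat"
    show "\<exists>r. x \<in> V \<longrightarrow> r \<notin> f ` ?N x"
    proof (cases "x \<in> V")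
      case True
      then show ?thesis
        using ex_new_if_finite[OF infinite_UNIV_nat finite_imageI[OF assms(2)]] by blast
    qed simp
  qed
  then obtain col :: "'a \<Rightarrow> nat" where col: "\<And>y. y \<in> V \<Longrightarrow> col y \<notin> col ` ?N y" by blast
  have "V = (\<Union>k. {x \<in> V. col x = k})" by auto
  then obtain k where "uncountable {x \<in> V. col x = k}"
    using assms(1) countable_UN[of UNIV "\<lambda>k. {x \<in> V. col x = k}"] by auto
  then show ?thesis
    using col by (intro exI[of _ "{x \<in> V. col x = k}"]) (auto simp: image_iff)
qed

section \<open>The families \<open>X\<close>\<close>

text \<open>Nodes of equal height are incomparable, so a level is an antichain.\<close>

lemma countable_level:
  assumes "suslin_tree S"
  shows "countable (level S \<alpha>)"
proof -
  have "\<not> s \<sqsubset> t" if "s \<in> level S \<alpha>" "t \<in> level S \<alpha>" for s t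
    using seq_less_ht[of s t] that assms by (auto simp: level_def suslin_tree_def)
  then have "is_antichain (level S \<alpha>)" by (simp add: is_antichain_def)
  moreover have "level S \<alpha> \<subseteq> S" by (auto simp: level_def)
  ultimately show ?thesis using assms by (simp add: suslin_tree_def)
qed

lemma countable_below: "suslin_tree S \<Longrightarrow> countable (below S \<alpha>)"
  unfolding below_def by (intro countable_UN countable_lessThan_omega1 countable_level)

lemma below_iff: "t \<in> below S \<alpha> \<longleftrightarrow> t \<in> S \<and> ht t < \<alpha>"
  by (auto simp: below_def level_def)

lemma XfamD:
  assumes "a \<in> Xfam S s n"
  shows "a \<subseteq> S" "finite a" "card a = 2 * n"
    and "s(ht s \<mapsto> False) \<subseteq>\<^sub>m el a 0" "s(ht s \<mapsto> True) \<subseteq>\<^sub>m el a n"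
    and "\<And>i. Suc i < n \<Longrightarrow> el a i \<subseteq>\<^sub>m el a (Suc i)"
    and "\<And>i. Suc i < n \<Longrightarrow> el a (n + i) \<subseteq>\<^sub>m el a (n + Suc i)"
    and "ht (el a (n - 1)) < ht (el a n)" "Dset (el a (n - 1)) (el a n) = {ht s}"
proof -
  note * = assms[unfolded Xfam_def mem_Collect_eq seq_less_def]
  show "a \<subseteq> S" "finite a" "card a = 2 * n"
    "s(ht s \<mapsto> False) \<subseteq>\<^sub>m el a 0" "s(ht s \<mapsto> True) \<subseteq>\<^sub>m el a n"
    "ht (el a (n - 1)) < ht (el a n)" "Dset (el a (n - 1)) (el a n) = {ht s}"
    using * by blast+
  show "\<And>i. Suc i < n \<Longrightarrow> el a i \<subseteq>\<^sub>m el a (Suc i)"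
    "\<And>i. Suc i < n \<Longrightarrow> el a (n + i) \<subseteq>\<^sub>m el a (n + Suc i)"
    using * by blast+
qed

context
  fixes S s n a
  assumes S: "S \<subseteq> binseqs" and s: "s \<in> binseqs" and n: "0 < n" and a: "a \<in> Xfam S s n"
begin

lemma Xfam_el_image: "el a ` {..<2 * n} = a"
  using el_image[of a] XfamD(1-3)[OF a] S by (metis order_trans)

lemma Xfam_el_mem: "i < 2 * n \<Longrightarrow> el a i \<in> a"
  using Xfam_el_image by blast

lemma Xfam_el_binseq: "i < 2 * n \<Longrightarrow> el a i \<in> binseqs"
  using Xfam_el_mem XfamD(1)[OF a] S by blast

lemma Xfam_el_chain:
  assumes "i \<le> j" "j < n"
  shows "el a i \<subseteq>\<^sub>m el a j" "el a (n + i) \<subseteq>\<^sub>m el a (n + j)"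
proof -
  show "el a i \<subseteq>\<^sub>m el a j"
    using assms
  proof (induction j rule: dec_induct)
    case (step k)
    show ?case
      by (rule map_le_trans[OF step.IH XfamD(6)[OF a]]) (use step.prems in simp_all)
  qed simp
  show "el a (n + i) \<subseteq>\<^sub>m el a (n + j)"
    using assms
  proof (induction j rule: dec_induct)
    case (step k)
    show ?case
      by (rule map_le_trans[OF step.IH XfamD(7)[OF a]]) (use step.prems in simp_all)
  qed simp
qed

lemma Xfam_stem:
  assumes "i < n"
  shows "s(ht s \<mapsto> False) \<subseteq>\<^sub>m el a i" "s(ht s \<mapsto> True) \<subseteq>\<^sub>m el a (n + i)"
proof -
  have "el a 0 \<subseteq>\<^sub>m el a i" "el a n \<subseteq>\<^sub>m el a (n + i)"
    using Xfam_el_chain[of 0 i] assms by simp_all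
  then show "s(ht s \<mapsto> False) \<subseteq>\<^sub>m el a i" "s(ht s \<mapsto> True) \<subseteq>\<^sub>m el a (n + i)"
    using XfamD(4,5)[OF a] map_le_trans by blast+
qed

lemma Xfam_el_at_stem:
  assumes "i < n"
  shows "el a i (ht s) = Some False" "el a (n + i) (ht s) = Some True"
  using Xfam_stem[OF assms] unfolding map_le_def by fastforce+

text \<open>Every member of \<open>a\<close> has a value at \<open>ht s\<close>: 0 in the lower
  half, 1 in the upper half.\<close>

lemma Xfam_ht:
  assumes "t \<in> a"
  shows "ht s < ht t"
proof -
  obtain i where i: "i < 2 * n" "t = el a i" using Xfam_el_image assms by blast
  have "t (ht s) \<noteq> None"
  proof (cases "i < n")
    case True
    then show ?thesis using Xfam_el_at_stem(1) i by simp
  next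
    case False
    then show ?thesis using Xfam_el_at_stem(2)[of "i - n"] i by simp
  qed
  then show ?thesis using binseq_None_iff Xfam_el_binseq i by (metis not_less)
qed

lemma Xfam_agree:
  assumes "\<xi> < ht (el a (n - 1))" "\<xi> \<noteq> ht s"
  shows "el a (n - 1) \<xi> = el a n \<xi>"
proof -
  have "\<xi> \<notin> Dset (el a (n - 1)) (el a n)" using XfamD(9)[OF a] assms(2) by simp
  then show ?thesis using assms(1) XfamD(8)[OF a] by (auto simp: Dset_def)
qed

lemma Xfam_stem_eq: "s = el a 0 |` {..<ht s}"
proof
  fix \<xi>
  show "s \<xi> = (el a 0 |` {..<ht s}) \<xi>"
  proof (cases "\<xi> < ht s")
    case True
    then have "\<xi> \<in> dom (s(ht s \<mapsto> False))" using dom_binseq[OF s] by auto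
    then have "(s(ht s \<mapsto> False)) \<xi> = el a 0 \<xi>"
      using Xfam_stem(1)[OF n] unfolding map_le_def by blast
    then show ?thesis using True by (auto split: if_splits)
  next
    case False
    then show ?thesis using binseq_None_iff[OF s] by simp
  qed
qed

end

text \<open>The number \<open>n\<close> is read off from the size of \<open>a\<close>,
  \<open>ht s\<close> from the singleton difference set, and \<open>s\<close> as a restriction of
  \<open>el a 0\<close>. Hence a family from \<open>F\<close> that meets \<open>Xfam S s n\<close>
  is contained in it.\<close>

lemma Xfam_unique:
  assumes "S \<subseteq> binseqs" "s \<in> S" "s' \<in> S" "0 < n" "0 < n'" "a \<in> Xfam S s n" "a \<in> Xfam S s' n'"
  shows "s = s'" "n = n'"
proof -
  show nn: "n = n'" using XfamD(3)[OF assms(6)] XfamD(3)[OF assms(7)] by simp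
  have "{ht s} = {ht s'}"
    using XfamD(9)[OF assms(6)] XfamD(9)[OF assms(7)] nn by simp
  moreover have "s = el a 0 |` {..<ht s}" "s' = el a 0 |` {..<ht s'}"
    using Xfam_stem_eq[OF assms(1) _ assms(4,6)] Xfam_stem_eq[OF assms(1) _ assms(5,7)] assms(1-3)
    by blast+
  ultimately show "s = s'" by simp
qed

section \<open>Compatible pairs\<close>

text \<open>The conclusion of the theorem for a single ordered pair; its failure will define the
  edges of the graph of bad pairs.\<close>

definition compatible :: "(seq set \<Rightarrow> bool) \<Rightarrow> nat \<Rightarrow> seq set \<Rightarrow> seq set \<Rightarrow> bool"
  where "compatible c n a b \<longleftrightarrow> (el a (2 * n - 1) \<sqsubset> el b (2 * n - 1) \<longrightarrow>
    (\<exists>i. \<forall>j<n. \<forall>k<n. c {el a j, el b k} = i \<and> c {el a (n + j), el b (n + k)} = (\<not> i)))"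

text \<open>Two initial segments of one sequence are comparable, and their heights decide the
  direction.\<close>

lemma seq_less_common_upper:
  assumes "p \<in> binseqs" "v \<in> binseqs" "p \<subseteq>\<^sub>m q" "v \<subseteq>\<^sub>m q" "ht p < ht v"
  shows "p \<sqsubset> v"
proof -
  have "p \<subseteq>\<^sub>m v"
  proof (rule map_leI_binseq[OF assms(1)])
    fix \<xi> assume "\<xi> < ht p"
    then show "p \<xi> = v \<xi>"
      using map_leD_binseq[of p q \<xi>] map_leD_binseq[of v q \<xi>] assms by simp
  qed
  then show ?thesis using assms(5) by (auto simp: seq_less_def)
qed

text \<open>Adds the trivial case \<open>u = t\<close> to (coh), which occurs when an element of
  \<open>b\<close> has height exactly \<alpha>.\<close>

lemma coh_finite:
  assumes "coh S c" "u \<in> S" "t \<in> S" "u \<subseteq>\<^sub>m t"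
  shows "finite {x \<in> S. x \<sqsubset> u \<and> c {x, u} \<noteq> c {x, t}}"
  using assms by (cases "u = t") (auto simp: coh_def seq_less_def)

text \<open>
  Cut \<open>b\<close> at the level \<open>\<alpha>\<close>: only two nodes \<open>u\<close>, \<open>v\<close> remain, which differ exactly at \<open>ht s\<close>.
  Property (hom) controls all but finitely many \<open>a\<close> against \<open>{u, v}\<close>, and (coh) transfers
  the colours from \<open>u\<close>, \<open>v\<close> to the elements of \<open>b\<close> above them, up to finitely many nodes.
\<close>

lemma finite_obstruction:
  assumes S: "suslin_tree S" and coh: "coh S c" and hom: "hom_property S F c"
    and s: "s \<in> S" and n: "0 < n"
    and B: "B \<in> F" "B \<subseteq> Xfam S s n" "card_omega1 B"
    and b: "b \<in> Xfam S s n" "\<And>t. t \<in> b \<Longrightarrow> \<alpha> \<le> ht t" and \<alpha>: "ht s < \<alpha>"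
  shows "\<exists>W. finite W \<and> (\<forall>a\<in>B. a \<subseteq> below S \<alpha> \<and> a \<inter> W = {} \<longrightarrow> compatible c n a b)"
proof -
  have Sb: "S \<subseteq> binseqs" and closed: "\<And>t \<alpha>. t \<in> S \<Longrightarrow> \<alpha> \<le> ht t \<Longrightarrow> t |` {..<\<alpha>} \<in> S"
    using S by (auto simp: suslin_tree_def)
  have sb: "s \<in> binseqs" using s Sb by blast
  note X = Sb sb n
  \<comment> \<open>All heights in \<open>b\<close> are at least \<alpha>, so each half of
    \<open>b\<close> has a single cut at \<alpha>. The indices \<open>n - 1\<close> and
    \<open>n\<close> are those whose difference set is prescribed in \<open>Xfam\<close>.\<close>
  define u where "u = el b (n - 1) |` {..<\<alpha>}"
  define v where "v = el b n |` {..<\<alpha>}"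
  have bS: "b \<subseteq> S" using XfamD(1)[OF b(1)] .
  have elb: "el b i \<in> S" "el b i \<in> binseqs" "\<alpha> \<le> ht (el b i)" if "i < 2 * n" for i
    using Xfam_el_mem[OF X b(1) that] bS Sb b(2) by auto
  have u: "u \<in> S" "u \<in> binseqs" "ht u = \<alpha>" and v: "v \<in> S" "v \<in> binseqs" "ht v = \<alpha>"
    using elb[of "n - 1"] elb[of n] n closed ht_restrict_binseq Sb
    unfolding u_def v_def by auto
  have u_le: "u \<subseteq>\<^sub>m el b k" if "k < n" for k
  proof (rule map_leI_binseq[OF u(2)])
    fix \<xi> assume "\<xi> < ht u"
    then show "u \<xi> = el b k \<xi>"
      using map_leD_binseq[of "el b k" "el b (n - 1)" \<xi>] Xfam_el_chain(1)[OF X b(1), of k "n - 1"]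
        elb[of k] that u(3) by (simp add: u_def)
  qed
  have v_le: "v \<subseteq>\<^sub>m el b (n + k)" if "k < n" for k
  proof (rule map_leI_binseq[OF v(2)])
    fix \<xi> assume "\<xi> < ht v"
    then show "v \<xi> = el b (n + k) \<xi>"
      using map_leD_binseq[of "el b n" "el b (n + k)" \<xi>] Xfam_el_chain(2)[OF X b(1), of 0 k]
        elb[of n] that v(3) n by (simp add: v_def)
  qed
  have uv: "u \<xi> = v \<xi>" if "\<xi> < \<alpha>" "\<xi> \<noteq> ht s" for \<xi>
  proof -
    have "\<alpha> \<le> ht (el b (n - 1))" using elb(3)[of "n - 1"] n by simp
    then show ?thesis
      using Xfam_agree[OF X b(1), of \<xi>] that by (simp add: u_def v_def)
  qed
  have us: "u (ht s) = Some False" and vs: "v (ht s) = Some True"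
    using Xfam_el_at_stem(1)[OF X b(1), of "n - 1"] Xfam_el_at_stem(2)[OF X b(1), of 0] n \<alpha>
    by (simp_all add: u_def v_def)
  \<comment> \<open>At \<open>ht s\<close>, the only difference, \<open>u\<close> has 0 and
    \<open>v\<close> has 1; so \<open>u\<close> plays the role of \<open>a(0)\<close> in (hom) and
    \<open>v\<close> that of \<open>a(1)\<close>.\<close>
  have "ho_less u v"
    using ho_less_iff[OF u(2) v(2)] u(3) v(3) us vs uv \<alpha> by auto
  then have el_uv: "el {u, v} 0 = u" "el {u, v} 1 = v" using el_pair u(2) v(2) by blast+
  have "Dset u v = {ht s}"
    using uv us vs \<alpha> u(3) v(3) by (auto simp: Dset_def)
  moreover have "card {u, v} = 2" using us vs by (metis card_2_iff option.inject)
  moreover have "{u, v} \<subseteq> level S \<alpha>" using u v by (simp add: level_def)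
  moreover have "s \<in> below S \<alpha>" using s \<alpha> by (simp add: below_iff)
  define E where "E = {a \<in> B. finite a \<and> a \<subseteq> below S \<alpha> \<and>
    \<not> (\<exists>i. el a (2 * n - 1) \<sqsubset> v \<longrightarrow> (\<forall>j<n. c {el a j, u} = i \<and> c {el a (n + j), v} = (\<not> i)))}"
  ultimately have finE: "finite E"
    using hom[unfolded hom_property_def, rule_format, of s \<alpha> n B "{u, v}"] \<open>s \<in> below S \<alpha>\<close> n B el_uv
    unfolding E_def by simp
  \<comment> \<open>The nodes at which (coh) fails to carry colours from \<open>u\<close> and
    \<open>v\<close> up to the two halves of \<open>b\<close>.\<close>
  define W1 where "W1 = (\<Union>k<n. {x \<in> S. x \<sqsubset> u \<and> c {x, u} \<noteq> c {x, el b k}})"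
  define W2 where "W2 = (\<Union>k<n. {x \<in> S. x \<sqsubset> v \<and> c {x, v} \<noteq> c {x, el b (n + k)}})"
  have finW: "finite W1" "finite W2"
    unfolding W1_def W2_def using coh_finite[OF coh] u(1) v(1) elb(1) u_le v_le by simp_all
  \<comment> \<open>The obstruction is to be a set of nodes, so the exceptional sets of (hom) enter
    through all their elements.\<close>
  have finE': "finite (\<Union>E)"
    by (rule finite_Union[OF finE]) (simp add: E_def)
  have comp: "compatible c n a b"
    if a: "a \<in> B" "a \<subseteq> below S \<alpha>" "a \<inter> (\<Union>E \<union> W1 \<union> W2) = {}" for a
    unfolding compatible_def
  proof
    assume less: "el a (2 * n - 1) \<sqsubset> el b (2 * n - 1)"
    have aX: "a \<in> Xfam S s n" using a(1) B(2) by blast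
    have ela: "el a i \<in> a" "el a i \<in> S" "el a i \<in> binseqs" "ht (el a i) < \<alpha>" if "i < 2 * n" for i
    proof -
      show "el a i \<in> a" by (rule Xfam_el_mem[OF X aX that])
      then have "el a i \<in> below S \<alpha>" using a(2) by blast
      then show "el a i \<in> S" "el a i \<in> binseqs" "ht (el a i) < \<alpha>"
        using Sb by (auto simp: below_iff)
    qed
    have n': "n - 1 < 2 * n" using n by simp
    have last: "2 * n - 1 = n + (n - 1)" using n by simp
    \<comment> \<open>The upper half of \<open>a\<close> and the cut \<open>v\<close> are all
      initial segments of the top node of \<open>b\<close>.\<close>
    have low: "el a (n + j) \<sqsubset> v" if "j < n" for j
    proof (rule seq_less_common_upper)
      show "el a (n + j) \<subseteq>\<^sub>m el b (n + (n - 1))"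
      proof (rule map_le_trans)
        show "el a (n + j) \<subseteq>\<^sub>m el a (n + (n - 1))"
          using Xfam_el_chain(2)[OF X aX, of j "n - 1"] that by simp
        show "el a (n + (n - 1)) \<subseteq>\<^sub>m el b (n + (n - 1))"
          using less unfolding last seq_less_def by blast
      qed
    qed (use ela[of "n + j"] v v_le[of "n - 1"] that in auto)
    \<comment> \<open>The assumption speaks of the upper half only. The lower half follows: off
      \<open>ht s\<close>, \<open>el a (n - 1)\<close> agrees with \<open>el a n\<close>, which
      agrees with \<open>v\<close>, which agrees with \<open>u\<close>; at \<open>ht s\<close> both
      sides are 0.\<close>
    have "el a (n - 1) \<subseteq>\<^sub>m u"
    proof (rule map_leI_binseq)
      fix \<xi> assume x: "\<xi> < ht (el a (n - 1))"
      show "el a (n - 1) \<xi> = u \<xi>"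
      proof (cases "\<xi> = ht s")
        case True
        then show ?thesis using us Xfam_el_at_stem(1)[OF X aX, of "n - 1"] n by simp
      next
        case False
        have "\<xi> < ht (el a n)" using x XfamD(8)[OF aX] by simp
        then have "el a n \<xi> = v \<xi>"
          using map_leD_binseq[of "el a n" v \<xi>] low[OF n] ela[of n] n by (simp add: seq_less_def)
        moreover have "\<xi> < \<alpha>" using x ela(4)[of "n - 1", OF n'] by simp
        ultimately show ?thesis using Xfam_agree[OF X aX x False] uv False by simp
      qed
    qed (rule ela(3)[OF n'])
    then have low': "el a j \<sqsubset> u" if "j < n" for j
      using map_le_trans[OF Xfam_el_chain(1)[OF X aX, of j "n - 1"]] that ela(4)[of j] u(3)
      by (auto simp: seq_less_def)
    \<comment> \<open>A nonempty set disjoint from \<open>\<Union>E\<close> cannot belong to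
      \<open>E\<close>.\<close>
    have "a \<notin> E" using a(3) ela(1)[of 0] n by auto
    moreover have "finite a" using XfamD(2)[OF aX] .
    ultimately obtain i where i: "\<And>j. j < n \<Longrightarrow> c {el a j, u} = i \<and> c {el a (n + j), v} = (\<not> i)"
      using a(1,2) low[of "n - 1"] n unfolding E_def last by auto
    have "c {el a j, el b k} = i \<and> c {el a (n + j), el b (n + k)} = (\<not> i)"
      if jk: "j < n" "k < n" for j k
    proof -
      have mem: "el a j \<in> a" "el a (n + j) \<in> a" using ela(1) jk(1) by simp_all
      then have "el a j \<notin> W1" "el a (n + j) \<notin> W2" using a(3) by blast+
      then have "c {el a j, u} = c {el a j, el b k}"
        "c {el a (n + j), v} = c {el a (n + j), el b (n + k)}"
        using low[OF jk(1)] low'[OF jk(1)] jk(2) mem XfamD(1)[OF aX]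
        unfolding W1_def W2_def by blast+
      then show ?thesis using i jk by simp
    qed
    then show "\<exists>i. \<forall>j<n. \<forall>k<n. c {el a j, el b k} = i \<and> c {el a (n + j), el b (n + k)} = (\<not> i)"
      by (intro exI[of _ i] allI impI)
  qed
  show ?thesis
  proof (intro exI conjI ballI impI)
    show "finite (\<Union>E \<union> W1 \<union> W2)" using finW finE' by simp
    fix a assume "a \<in> B" "a \<subseteq> below S \<alpha> \<and> a \<inter> (\<Union>E \<union> W1 \<union> W2) = {}"
    then show "compatible c n a b" by (elim conjE) (rule comp)
  qed
qed

section \<open>Thinning out\<close>

text \<open>Points of \<open>W\<close> picked from disjoint sets are distinct. So no more sets of
  the family meet \<open>W\<close> than \<open>W\<close> has points; this is applied to countable
  and to finite \<open>W\<close>.\<close>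

lemma disjoint_family_on_transversal:
  assumes "disjoint_family_on f I"
  shows "\<exists>g. inj_on g {i \<in> I. f i \<inter> W \<noteq> {}} \<and> g ` {i \<in> I. f i \<inter> W \<noteq> {}} \<subseteq> W"
proof -
  define g where "g i = (SOME t. t \<in> f i \<inter> W)" for i
  have g: "g i \<in> f i \<inter> W" if "f i \<inter> W \<noteq> {}" for i
    unfolding g_def by (rule someI_ex) (use that in blast)
  have "inj_on g {i \<in> I. f i \<inter> W \<noteq> {}}"
  proof (rule inj_onI, rule ccontr)
    fix i j assume ij: "i \<in> {i \<in> I. f i \<inter> W \<noteq> {}}" "j \<in> {i \<in> I. f i \<inter> W \<noteq> {}}" "g i = g j" "i \<noteq> j"
    then have "f i \<inter> f j = {}" using disjoint_family_onD[OF assms, of i j] by simp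
    then show False using g[of i] g[of j] ij(1-3) by auto
  qed
  moreover have "g ` {i \<in> I. f i \<inter> W \<noteq> {}} \<subseteq> W" using g by blast
  ultimately show ?thesis by blast
qed

text \<open>Induction on the common size \<open>m\<close>. One element \<open>g i\<close> is picked
  from each \<open>f i\<close>; the guessing property of \<open>F\<close> yields a \<open>B\<close>
  containing uncountably many of them, and the induction hypothesis treats the rest of
  \<open>f i\<close> for those indices.\<close>

lemma kurepa_finite_cover:
  assumes S: "S \<subseteq> binseqs" and F: "kurepa_family S F" and s: "s \<in> S" and n: "0 < n"
    and "uncountable I" "\<And>i. i \<in> I \<Longrightarrow> finite (f i) \<and> card (f i) = m \<and> f i \<subseteq> Xfam S s n"
    and "disjoint_family_on (\<lambda>i. \<Union>(f i)) I"
  shows "\<exists>J\<subseteq>I. \<exists>G\<subseteq>F. uncountable J \<and> finite G \<and> (\<forall>B\<in>G. B \<subseteq> Xfam S s n) \<and> (\<forall>i\<in>J. f i \<subseteq> \<Union>G)"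
  using assms(5-7)
proof (induction m arbitrary: I f)
  case 0
  have "f i = {}" if "i \<in> I" for i using 0(2)[OF that] by auto
  then have "\<forall>i\<in>I. f i \<subseteq> \<Union>{}" by simp
  then show ?case using 0(1) by blast
next
  case (Suc m)
  have sb: "s \<in> binseqs" using s S by blast
  have "\<exists>a. a \<in> f i" if "i \<in> I" for i using Suc.prems(2)[OF that] by (metis card_eq_0_iff ex_in_conv nat.distinct(1))
  then obtain g where g: "\<And>i. i \<in> I \<Longrightarrow> g i \<in> f i" by metis
  have gX: "g i \<in> Xfam S s n" if "i \<in> I" for i using g Suc.prems(2) that by blast
  have dj: "g i \<inter> g j = {}" if "i \<in> I" "j \<in> I" "i \<noteq> j" for i j
    using Suc.prems(3) g that unfolding disjoint_family_on_def by blast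
  \<comment> \<open>Pairwise disjoint sets can coincide only when empty, so nonemptiness makes
    \<open>g\<close> injective.\<close>
  have "g i \<noteq> {}" if "i \<in> I" for i using Xfam_el_mem[OF S sb n gX[OF that], of 0] n by auto
  then have "inj_on g I" using dj by (metis inf.idem inj_onI)
  then have "uncountable (g ` I)" using Suc.prems(1) countable_image_inj_on by blast
  moreover have "disjoint (g ` I)" using dj by (auto simp: pairwise_def disjnt_def)
  moreover have "g ` I \<subseteq> Xfam S s n" using gX by blast
  ultimately obtain B where B: "B \<in> F" "card_omega1 (g ` I \<inter> B)"
    using F[unfolded kurepa_family_def, THEN conjunct2, THEN conjunct2, THEN conjunct1,
        rule_format, OF s n, of "g ` I"] by blast
  define I' where "I' = {i \<in> I. g i \<in> B}"
  have "g ` I \<inter> B = g ` I'" by (auto simp: I'_def)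
  then have unc: "uncountable I'"
    using card_omega1_uncountable[OF B(2)] countable_image[of I' g] by metis
  then have "I' \<noteq> {}" by (rule contrapos_nn) simp
  \<comment> \<open>A single common element places all of \<open>B\<close> inside
    \<open>Xfam S s n\<close>.\<close>
  then obtain i where "i \<in> I'" by blast
  then have "g i \<in> Xfam S s n" "g i \<in> B" using gX by (auto simp: I'_def)
  moreover obtain s' n' where s': "s' \<in> S" "0 < n'" "B \<subseteq> Xfam S s' n'"
    using F[unfolded kurepa_family_def, THEN conjunct1, rule_format, OF B(1)] by blast
  ultimately have "g i \<in> Xfam S s n" "g i \<in> Xfam S s' n'" by auto
  from Xfam_unique[OF S s s'(1) n s'(2) this] have BX: "B \<subseteq> Xfam S s n" using s'(3) by simp
  have fin: "finite (f i - {g i}) \<and> card (f i - {g i}) = m \<and> f i - {g i} \<subseteq> Xfam S s n" if "i \<in> I'" for i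
  proof -
    have "i \<in> I" using that by (simp add: I'_def)
    from Suc.prems(2)[OF this] g[OF this] show ?thesis by auto
  qed
  have "disjoint_family_on (\<lambda>i. \<Union>(f i - {g i})) I'"
    unfolding disjoint_family_on_def
  proof (intro ballI impI)
    fix i j assume "i \<in> I'" "j \<in> I'" "i \<noteq> j"
    then have "\<Union>(f i) \<inter> \<Union>(f j) = {}"
      using Suc.prems(3) by (simp add: disjoint_family_on_def I'_def)
    then show "\<Union>(f i - {g i}) \<inter> \<Union>(f j - {g j}) = {}" by blast
  qed
  then have "\<exists>J\<subseteq>I'. \<exists>G\<subseteq>F. uncountable J \<and> finite G \<and> (\<forall>B\<in>G. B \<subseteq> Xfam S s n) \<and>
      (\<forall>i\<in>J. f i - {g i} \<subseteq> \<Union>G)"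
    using Suc.IH[of I' "\<lambda>i. f i - {g i}", OF unc fin] by simp
  then obtain J G where
    J: "J \<subseteq> I'" "G \<subseteq> F" "uncountable J" "finite G" "\<forall>B\<in>G. B \<subseteq> Xfam S s n"
      "\<forall>i\<in>J. f i - {g i} \<subseteq> \<Union>G" by (elim exE conjE) (rule that)
  have cov: "f i \<subseteq> \<Union>(insert B G)" if "i \<in> J" for i
  proof -
    have "g i \<in> B" using J(1) that by (auto simp: I'_def)
    moreover have "f i - {g i} \<subseteq> \<Union>G" using J(6) that by blast
    ultimately show ?thesis by blast
  qed
  show ?case
  proof (intro exI conjI ballI)
    show "J \<subseteq> I" using J(1) by (auto simp: I'_def)
    show "insert B G \<subseteq> F" "finite (insert B G)" using J(2,4) B(1) by simp_all
    show "D \<subseteq> Xfam S s n" if "D \<in> insert B G" for D using that J(5) BX by blast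
  qed (fact J(3) cov)+
qed

text \<open>A finite union \<open>U\<close> comes only from the finitely many subsets of
  \<open>Pow U\<close>, so uncountably many unions occur, and one member is kept for each. This
  matters because disjointness is assumed for the set of unions, where different members may share
  one.\<close>

lemma uncountable_inj_Union_subset:
  assumes "uncountable A" "\<And>x. x \<in> A \<Longrightarrow> finite (\<Union>x)"
  shows "\<exists>A'\<subseteq>A. uncountable A' \<and> inj_on Union A'"
proof -
  have "A \<subseteq> (\<Union>U\<in>Union ` A. Pow (Pow U))" by auto
  moreover have "countable (\<Union>U\<in>Union ` A. Pow (Pow U))" if "countable (Union ` A)"
    using that by (rule countable_UN) (use assms(2) in \<open>auto intro: countable_finite\<close>)
  ultimately have "uncountable (Union ` A)" using assms(1) countable_subset by blast
  moreover obtain A' where "A' \<subseteq> A" "inj_on Union A'" "Union ` A = Union ` A'"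
    using subset_image_inj[of "Union ` A" Union A, THEN iffD1, OF order_refl] by (elim exE conjE) (rule that)
  ultimately have "uncountable (Union ` A')" by simp
  then have "uncountable A'" by (rule contrapos_nn) (rule countable_image)
  then show ?thesis using \<open>A' \<subseteq> A\<close> \<open>inj_on Union A'\<close> by blast
qed

definition separated :: "seq set \<Rightarrow> seq set \<Rightarrow> bool"
  where "separated p q \<longleftrightarrow> (\<forall>t\<in>p. \<forall>t'\<in>q. ht t < ht t') \<or> (\<forall>t\<in>p. \<forall>t'\<in>q. ht t' < ht t)"

text \<open>A countable \<open>C\<close> has heights bounded by some \<beta>. The part of
  \<open>S\<close> below \<beta> is countable, so by disjointness only countably many members meet
  it; any other member outside \<open>C\<close> lies entirely above \<open>C\<close>.\<close>

lemma uncountable_separated_subset: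
  assumes S: "suslin_tree S" and "uncountable A" "disjoint_family_on Union A"
    and "\<And>x. x \<in> A \<Longrightarrow> finite (\<Union>x) \<and> \<Union>x \<subseteq> S"
  shows "\<exists>B\<subseteq>A. uncountable B \<and> pairwise (\<lambda>x y. separated (\<Union>x) (\<Union>y)) B"
proof (rule uncountable_pairwise_subset)
  show "symp (\<lambda>x y. separated (\<Union>x) (\<Union>y))" unfolding symp_def separated_def by blast
next
  fix C assume C: "C \<subseteq> A" "countable C"
  have "finite (ht ` \<Union>x)" if "x \<in> C" for x using assms(4)[of x] C(1) that by blast
  then have "countable (\<Union>x\<in>C. ht ` \<Union>x)"
    by (intro countable_UN[OF C(2)] countable_finite)
  from omega1_countable_bound[OF this] obtain \<beta> where "\<forall>\<gamma>\<in>(\<Union>x\<in>C. ht ` \<Union>x). \<gamma> < \<beta>" ..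
  then have \<beta>: "ht t < \<beta>" if "x \<in> C" "t \<in> \<Union>x" for x t using that by blast
  let ?D = "{x \<in> A. \<Union>x \<inter> below S \<beta> \<noteq> {}}"
  obtain g where "inj_on g ?D" "g ` ?D \<subseteq> below S \<beta>"
    using disjoint_family_on_transversal[OF assms(3), of "below S \<beta>"] by (elim exE conjE) (rule that)
  then have "countable ?D"
    by (intro countable_image_inj_on[of g] countable_subset[OF _ countable_below[OF S]])
  then have "countable (C \<union> ?D)" using C(2) by simp
  then have "\<not> A \<subseteq> C \<union> ?D" using assms(2) countable_subset[of A "C \<union> ?D"] by blast
  then obtain x where x: "x \<in> A" "x \<notin> C" "\<Union>x \<inter> below S \<beta> = {}" by blast
  have ge: "\<beta> \<le> ht t" if "t \<in> \<Union>x" for t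
  proof -
    have "t \<in> S" "t \<notin> below S \<beta>" using that x(3) assms(4)[OF x(1)] by blast+
    then show ?thesis by (simp add: below_iff)
  qed
  show "\<exists>x\<in>A - C. \<forall>y\<in>C. separated (\<Union>x) (\<Union>y)"
  proof (intro bexI ballI)
    fix y assume y: "y \<in> C"
    show "separated (\<Union>x) (\<Union>y)"
      unfolding separated_def
      by (intro disjI2 ballI) (rule less_le_trans[OF \<beta>[OF y] ge])
  qed (use x in simp)
qed

theorem theorem17:
  fixes S :: "seq set" and F :: "seq set set set" and c :: "seq set \<Rightarrow> bool"
    and s :: seq and n :: nat and A :: "seq set set set"
  assumes "suslin_tree S" and "complete_coherent S"
    and "kurepa_family S F"
    and "coh S c" and "hom_property S F c"
    and "s \<in> S" and "0 < n"
    and "uncountable A" and "\<And>x. x \<in> A \<Longrightarrow> finite x \<and> x \<subseteq> Xfam S s n"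
    and "disjoint {\<Union>x |x. x \<in> A}"
  shows "\<exists>B\<subseteq>A. card_omega1 B \<and>
    (\<forall>x\<in>B. \<forall>y\<in>B. x \<noteq> y \<longrightarrow> (\<forall>a\<in>x. \<forall>b\<in>y.
       el a (2 * n - 1) \<sqsubset> el b (2 * n - 1) \<longrightarrow>
       (\<exists>i. \<forall>j<n. \<forall>k<n.
          c {el a j, el b k} = i \<and> c {el a (n + j), el b (n + k)} = (\<not> i))))"
proof -
  have Sb: "S \<subseteq> binseqs" using assms(1) by (simp add: suslin_tree_def)
  then have sb: "s \<in> binseqs" using assms(6) by blast
  note X = Sb sb assms(7)

  \<comment> \<open>Refinement to a family separated by heights\<close>
  have AU: "finite (\<Union>x) \<and> \<Union>x \<subseteq> S" if "x \<in> A" for x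
    using assms(9)[OF that] XfamD(1,2) by blast
  obtain A1 where A1: "A1 \<subseteq> A" "uncountable A1" "inj_on Union A1"
    using uncountable_inj_Union_subset[OF assms(8)] AU by blast
  \<comment> \<open>A common size \<open>m\<close> is what the covering induction runs on; the empty
    member is dropped so that minimal heights exist.\<close>
  have "A1 - {{}} = (\<Union>m. {x \<in> A1 - {{}}. card x = m})" by auto
  moreover have "uncountable (A1 - {{}})" using A1(2) by (simp add: uncountable_minus_countable)
  ultimately obtain m where unc2: "uncountable {x \<in> A1 - {{}}. card x = m}"
    using countable_UN[of UNIV "\<lambda>m. {x \<in> A1 - {{}}. card x = m}"] by auto
  define A2 where "A2 = {x \<in> A1 - {{}}. card x = m}"
  have disj: "disjoint_family_on Union A2"
    unfolding disjoint_family_on_def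
  proof (intro ballI impI)
    fix x y assume "x \<in> A2" "y \<in> A2" "x \<noteq> y"
    then have "x \<in> A" "y \<in> A" "\<Union>x \<noteq> \<Union>y" using A1 by (auto simp: A2_def dest: inj_onD)
    then show "\<Union>x \<inter> \<Union>y = {}" using assms(10) by (auto simp: pairwise_def disjnt_def)
  qed
  have A2: "finite x \<and> card x = m \<and> x \<subseteq> Xfam S s n" "x \<in> A" "x \<noteq> {}" if "x \<in> A2" for x
    using assms(9)[of x] that A1(1) by (auto simp: A2_def)
  have "\<exists>A3\<subseteq>A2. \<exists>G\<subseteq>F. uncountable A3 \<and> finite G \<and> (\<forall>B\<in>G. B \<subseteq> Xfam S s n) \<and> (\<forall>x\<in>A3. x \<subseteq> \<Union>G)"
    using unc2[folded A2_def] A2(1) disj by (rule kurepa_finite_cover[OF Sb assms(3,6,7)])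
  then obtain A3 G where A3: "A3 \<subseteq> A2" "uncountable A3" "\<forall>x\<in>A3. x \<subseteq> \<Union>G"
    and G: "G \<subseteq> F" "finite G" "\<forall>B\<in>G. B \<subseteq> Xfam S s n" by (elim exE conjE) (rule that)
  have "disjoint_family_on Union A3" using disj A3(1) by (rule disjoint_family_on_mono[rotated])
  then obtain V where V: "V \<subseteq> A3" "uncountable V" "pairwise (\<lambda>x y. separated (\<Union>x) (\<Union>y)) V"
    using uncountable_separated_subset[OF assms(1) A3(2)] AU[OF A2(2)] A3(1) by blast
  have VX: "x \<in> A" "x \<subseteq> Xfam S s n" "x \<subseteq> \<Union>G" "finite x" "x \<noteq> {}" "finite (\<Union>x)" "\<Union>x \<subseteq> S"
    if "x \<in> V" for x
  proof -
    have x: "x \<in> A3" "x \<in> A2" using that V(1) A3(1) by blast+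
    show "x \<in> A" "x \<subseteq> Xfam S s n" "finite x" "x \<noteq> {}" using A2[OF x(2)] by blast+
    show "x \<subseteq> \<Union>G" using A3(3) x(1) by blast
    show "finite (\<Union>x)" "\<Union>x \<subseteq> S" using AU[OF A2(2)[OF x(2)]] by blast+
  qed
  have ne: "\<Union>x \<noteq> {}" if "x \<in> V" for x
  proof -
    obtain a where a: "a \<in> x" using VX(5)[OF \<open>x \<in> V\<close>] by blast
    then have "a \<in> Xfam S s n" using VX(2)[OF \<open>x \<in> V\<close>] by blast
    from Xfam_el_mem[OF X this, of 0] show ?thesis using a assms(7) by auto
  qed
  \<comment> \<open>The minimal height serves three times: as the level at which (hom) is applied,
    as the rank for the greedy colouring, and as the injection into \<omega>1.\<close>
  define h where "h x = Min (ht ` \<Union>x)" for x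
  have h_le: "h x \<le> ht t" if "x \<in> V" "t \<in> \<Union>x" for x t
    unfolding h_def by (intro Min_le finite_imageI VX(6) imageI that)
  have h_mem: "h x \<in> ht ` \<Union>x" if "x \<in> V" for x
    unfolding h_def by (intro Min_in finite_imageI VX(6) that) (use ne[OF that] in simp)
  have sep: "h x < h y \<and> (\<forall>t\<in>\<Union>x. \<forall>t'\<in>\<Union>y. ht t < ht t') \<or> h y < h x \<and> (\<forall>t\<in>\<Union>x. \<forall>t'\<in>\<Union>y. ht t' < ht t)"
    if xy: "x \<in> V" "y \<in> V" "x \<noteq> y" for x y
  proof -
    have "separated (\<Union>x) (\<Union>y)" by (rule pairwiseD[OF V(3) xy])
    moreover obtain t t' where t: "t \<in> \<Union>x" "h x = ht t" "t' \<in> \<Union>y" "h y = ht t'"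
      using h_mem[OF xy(1)] h_mem[OF xy(2)] by (elim imageE) (rule that)
    ultimately show ?thesis unfolding separated_def t(2,4) using t(1,3) by blast
  qed
  have below_h: "\<Union>x \<subseteq> below S (h y)" if xy: "x \<in> V" "y \<in> V" "h x < h y" for x y
  proof -
    have "x \<noteq> y" using xy(3) by blast
    then have *: "\<forall>t\<in>\<Union>x. \<forall>t'\<in>\<Union>y. ht t < ht t'" using sep[OF xy(1,2)] less_asym[OF xy(3)] by blast
    obtain t' where "t' \<in> \<Union>y" "h y = ht t'" using h_mem[OF xy(2)] by (elim imageE) (rule that)
    then show ?thesis using * VX(7)[OF xy(1)] below_iff by auto
  qed

  \<comment> \<open>Finiteness of the set of bad predecessors\<close>
  define bad where "bad x y \<longleftrightarrow> (\<exists>a\<in>x. \<exists>b\<in>y. \<not> compatible c n a b)" for x y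
  have fin_bad: "finite {x \<in> V. h x < h y \<and> bad x y}" if y: "y \<in> V" for y
  proof -
    define P where "P b B W \<longleftrightarrow>
      finite W \<and> (\<forall>a\<in>B. a \<subseteq> below S (h y) \<and> a \<inter> W = {} \<longrightarrow> compatible c n a b)" for b B W
    \<comment> \<open>One finite obstruction is chosen for each \<open>b\<close> in \<open>y\<close>
      and each \<open>B\<close> in \<open>G\<close>; both index sets are finite.\<close>
    define W where "W b B = (SOME W. P b B W)" for b B
    have W: "P b B (W b B)" if bB: "b \<in> y" "B \<in> G" for b B
      unfolding W_def
    proof (rule someI_ex, unfold P_def, rule finite_obstruction[OF assms(1,4,5,6,7)])
      show BF: "B \<in> F" and "B \<subseteq> Xfam S s n" and "b \<in> Xfam S s n"
        using G(1,3) bB VX(2)[OF y] by blast+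
      show "card_omega1 B"
        using assms(3)[unfolded kurepa_family_def, THEN conjunct1, rule_format, OF BF] by blast
      show "h y \<le> ht t" if "t \<in> b" for t
        by (rule h_le[OF y UnionI[OF bB(1) that]])
      obtain t where t: "t \<in> \<Union>y" "h y = ht t" using h_mem[OF y] by (elim imageE) (rule that)
      then obtain b' where b': "b' \<in> y" "t \<in> b'" by blast
      have "b' \<in> Xfam S s n" using VX(2)[OF y] b'(1) by blast
      from Xfam_ht[OF X this b'(2)] show "ht s < h y" using t(2) by simp
    qed
    let ?W = "\<Union>b\<in>y. \<Union>B\<in>G. W b B"
    \<comment> \<open>A bad pair has its lower component \<open>a\<close> in some \<open>B\<close>
      from the finite cover \<open>G\<close>, so \<open>a\<close> must meet the obstruction for that
      \<open>B\<close>.\<close>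
    have "\<Union>x \<inter> ?W \<noteq> {}" if x: "x \<in> V" "h x < h y" "bad x y" for x
    proof -
      obtain a b where ab: "a \<in> x" "b \<in> y" "\<not> compatible c n a b"
        using x(3) unfolding bad_def by (elim bexE) (rule that)
      then obtain B where B: "B \<in> G" "a \<in> B" using VX(3)[OF x(1)] by blast
      moreover have "a \<subseteq> below S (h y)" using below_h[OF x(1) y x(2)] ab(1) by blast
      ultimately have "a \<inter> W b B \<noteq> {}"
        using W[OF ab(2) B(1), unfolded P_def, THEN conjunct2] ab(3) by blast
      then show ?thesis using ab(1,2) B(1) by blast
    qed
    then have "{x \<in> V. h x < h y \<and> bad x y} \<subseteq> {x \<in> V. \<Union>x \<inter> ?W \<noteq> {}}" by blast
    moreover have "finite {x \<in> V. \<Union>x \<inter> ?W \<noteq> {}}"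
    proof -
      have "finite ?W"
      proof (intro finite_UN_I VX(4)[OF y] G(2))
        fix b B assume "b \<in> y" "B \<in> G"
        then show "finite (W b B)" using W[unfolded P_def] by blast
      qed
      moreover have "disjoint_family_on Union V"
        by (rule disjoint_family_on_mono[OF order_trans[OF V(1) A3(1)] disj])
      from disjoint_family_on_transversal[OF this, of ?W] obtain g
        where "inj_on g {x \<in> V. \<Union>x \<inter> ?W \<noteq> {}}" "g ` {x \<in> V. \<Union>x \<inter> ?W \<noteq> {}} \<subseteq> ?W"
        by (elim exE conjE) (rule that)
      ultimately show ?thesis by (intro inj_on_finite[of g])
    qed
    ultimately show ?thesis by (rule finite_subset)
  qed

  \<comment> \<open>An uncountable subfamily without bad pairs\<close>
  have "\<exists>B\<subseteq>V. uncountable B \<and> (\<forall>x\<in>B. \<forall>y\<in>B. h x < h y \<longrightarrow> \<not> bad x y)"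
    by (rule uncountable_free_subset[OF V(2) fin_bad])
  then obtain B where
    B: "B \<subseteq> V" "uncountable B" "\<forall>x\<in>B. \<forall>y\<in>B. h x < h y \<longrightarrow> \<not> bad x y"
    by (elim exE conjE) (rule that)
  have "inj_on h B"
  proof (rule inj_onI, rule ccontr)
    fix x y assume xy: "x \<in> B" "y \<in> B" "h x = h y" "x \<noteq> y"
    then have "x \<in> V" "y \<in> V" using B(1) by blast+
    from sep[OF this xy(4)] show False using xy(3) by simp
  qed
  then have "card_omega1 B" by (rule card_omega1I[OF B(2)])
  moreover have "\<exists>i. \<forall>j<n. \<forall>k<n. c {el a j, el b k} = i \<and> c {el a (n + j), el b (n + k)} = (\<not> i)"
    if xy: "x \<in> B" "y \<in> B" "x \<noteq> y" and ab: "a \<in> x" "b \<in> y" "el a (2 * n - 1) \<sqsubset> el b (2 * n - 1)" for x y a b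
  proof -
    have V: "x \<in> V" "y \<in> V" using B(1) xy by blast+
    have X': "a \<in> Xfam S s n" "b \<in> Xfam S s n" using VX(2)[OF V(1)] VX(2)[OF V(2)] ab by blast+
    have last: "2 * n - 1 < 2 * n" using assms(7) by simp
    have mem: "el a (2 * n - 1) \<in> \<Union>x" "el b (2 * n - 1) \<in> \<Union>y"
      using Xfam_el_mem[OF X X'(1) last] Xfam_el_mem[OF X X'(2) last] ab(1,2) by blast+
    \<comment> \<open>The order of the two top nodes forces \<open>h x < h y\<close> by separation,
      so excluding bad pairs in the direction of increasing \<open>h\<close> suffices.\<close>
    have "ht (el a (2 * n - 1)) < ht (el b (2 * n - 1))"
      by (rule seq_less_ht[OF _ _ ab(3)]) (rule Xfam_el_binseq[OF X X'(1) last] Xfam_el_binseq[OF X X'(2) last])+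
    then have "h x < h y" using sep[OF V xy(3)] mem less_asym by blast
    then have "\<not> bad x y" using B(3) xy(1,2) by blast
    then have "compatible c n a b" using ab(1,2) unfolding bad_def by blast
    then show ?thesis using ab(3) unfolding compatible_def by (rule mp)
  qed
  moreover have "B \<subseteq> A" using B(1) VX(1) by blast
  ultimately show ?thesis by (intro exI[of _ B] conjI ballI impI)
qed

end
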